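(* If $\bar\Lambda=0$, then $n^{Y_d}(\varepsilon)=1$ for all $\varepsilon\in(0,1)$ and $d\in\mathbb N$. If $\bar\Lambda\ne0$ and $\varepsilon_0:=(\bar\Lambda/\Lambda)^{1/2}<1$, then $n^{Y_d}(\varepsilon)=1$ for all $\varepsilon\in[\varepsilon_0,1)$ and all $d\in\mathbb N$.
   Context: $\mathbb N$ is the set of positive integers. $X_j(t)$, $t\in[0,1]$, $j\in\mathbb N$, are random processes on a common probability space, jointly measurable with sample paths in $L_2([0,1])$. All $X_j$ have zero mean and the same continuous covariance function $\mathcal K(t,s)=\mathbb E\,X_j(t)X_j(s)$, $t,s\in[0,1]$, and they are uncorrelated: $\mathbb E\,X_j(t)X_k(s)=0$ for $j\ne k$ and all $t,s$. For $d\in\mathbb N$ define $$Y_d(t):=\sum_{j=1}^d X_j(t_j),\quad t=(t_1,\dots,t_d)\in[0,1]^d.$$ Constants: $\Lambda:=\int_0^1\mathcal K(s,s)\,ds$, $\bar\lambda_0:=\int_0^1\int_0^1\mathcal K(t,s)\,dt\,ds$, $\bar\Lambda:=\Lambda-\bar\lambda_0$. $\langle\cdot,\cdot\rangle_{2,d}$ and $\|\cdot\|_{2,d}$ are the scalar product and norm of $L_2([0,1]^d)$. For a zero-mean random field $V_d$ with sample paths in $L_2([0,1]^d)$ put $e^{V_d}(0):=(\mathbb E\|V_d\|_{2,d}^2)^{1/2}$ and, for $n\in\mathbb N$, $$e^{V_d}(n):=\inf\Bigl\{\Bigl(\mathbb E\Bigl\|V_d-\sum_{m=1}^n\langle V_d,\psi_m\rangle_{2,d}\,\psi_m\Bigr\|_{2,d}^2\Bigr)^{1/2}:\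 \psi_1,\dots,\psi_n\in L_2([0,1]^d)\Bigr\}.$$ The average case approximation complexity is $$n^{V_d}(\varepsilon):=\min\{n\in\mathbb N:\ e^{V_d}(n)\leqslant\varepsilon\, e^{V_d}(0)\},\quad \varepsilon\in(0,1).$$ *)

theory Defs
  imports "HOL-Probability.Probability"
begin

text \<open>
  Square-integrable functions are represented by Borel-measurable functions rather than by
  classes modulo null sets; every class of \<open>L\<^sub>2([0,1]\<^sup>d)\<close> has a Borel representative, and the
  quantities below do not depend on its choice.
\<close>

definition L2 :: "'b measure \<Rightarrow> ('b \<Rightarrow> real) set" where
  "L2 N = {f \<in> borel_measurable N. integrable N (\<lambda>x. (f x)\<^sup>2)}"

definition L2_inner :: "'b measure \<Rightarrow> ('b \<Rightarrow> real) \<Rightarrow> ('b \<Rightarrow> real) \<Rightarrow> real" where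
  "L2_inner N f g = (\<integral>x. f x * g x \<partial>N)"

definition L2_norm :: "'b measure \<Rightarrow> ('b \<Rightarrow> real) \<Rightarrow> real" where
  "L2_norm N f = sqrt (L2_inner N f f)"

definition unit_interval :: "real measure" where
  "unit_interval = restrict_space lborel {0..1}"

text \<open>
  A point \<open>(t\<^sub>1, \<dots>, t\<^sub>d)\<close> of \<open>[0,1]\<^sup>d\<close> is an extensional function on \<open>{1..d}\<close>.
\<close>

definition unit_cube :: "nat \<Rightarrow> (nat \<Rightarrow> real) measure" where
  "unit_cube d = PiM {1..d} (\<lambda>_. unit_interval)"

text \<open>
  A random field is written \<open>V t \<omega>\<close>, with sample paths \<open>\<lambda>t. V t \<omega>\<close>. The expectations are
  Bochner integrals, so the next two definitions are meant for fields with
  \<open>E \<parallel>V\<parallel>\<^sup>2 < \<infinity>\<close>; all the expectations that occur are then finite.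
\<close>

definition avg_error ::
  "'a measure \<Rightarrow> nat \<Rightarrow> ((nat \<Rightarrow> real) \<Rightarrow> 'a \<Rightarrow> real) \<Rightarrow> nat \<Rightarrow> real" where
  "avg_error M d V n =
    (if n = 0 then sqrt (\<integral>\<omega>. (L2_norm (unit_cube d) (\<lambda>t. V t \<omega>))\<^sup>2 \<partial>M)
     else Inf {sqrt (\<integral>\<omega>. (L2_norm (unit_cube d)
                    (\<lambda>t. V t \<omega> - (\<Sum>m=1..n.
                       L2_inner (unit_cube d) (\<lambda>s. V s \<omega>) (\<psi> m) * \<psi> m t)))\<^sup>2 \<partial>M)
               | \<psi> :: nat \<Rightarrow> (nat \<Rightarrow> real) \<Rightarrow> real. \<forall>m\<in>{1..n}. \<psi> m \<in> L2 (unit_cube d)})"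

definition approx_complexity ::
  "'a measure \<Rightarrow> nat \<Rightarrow> ((nat \<Rightarrow> real) \<Rightarrow> 'a \<Rightarrow> real) \<Rightarrow> real \<Rightarrow> nat" where
  "approx_complexity M d V \<epsilon> =
    (LEAST n. 1 \<le> n \<and> avg_error M d V n \<le> \<epsilon> * avg_error M d V 0)"

definition additive_field ::
  "(nat \<Rightarrow> real \<Rightarrow> 'a \<Rightarrow> real) \<Rightarrow> nat \<Rightarrow> (nat \<Rightarrow> real) \<Rightarrow> 'a \<Rightarrow> real" where
  "additive_field X d t \<omega> = (\<Sum>j=1..d. X j (t j) \<omega>)"

definition Lam :: "(real \<Rightarrow> real \<Rightarrow> real) \<Rightarrow> real" where
  "Lam K = (LBINT s:{0..1}. K s s)"

definition lam_bar0 :: "(real \<Rightarrow> real \<Rightarrow> real) \<Rightarrow> real" where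
  "lam_bar0 K = (LBINT s:{0..1}. (LBINT t:{0..1}. K t s))"

definition Lam_bar :: "(real \<Rightarrow> real \<Rightarrow> real) \<Rightarrow> real" where
  "Lam_bar K = Lam K - lam_bar0 K"

end

theory Submission
  imports Defs
begin

text \<open>
  A single approximating function, the constant \<open>1\<close>, suffices. The coordinates of a point of the
  cube are independent under the uniform distribution, so for each \<open>\<omega>\<close> the squared distance of
  the path of \<open>Y\<^sub>d\<close> to its mean over the cube is a variance, equal to
  \<open>\<Sum>\<^sub>j (\<integral> X\<^sub>j\<^sup>2 - (\<integral> X\<^sub>j)\<^sup>2)\<close>, whose expectation is \<open>d\<close> times \<open>Lam_bar K\<close>. The squared mean
  \<open>(\<Sum>\<^sub>j \<integral> X\<^sub>j)\<^sup>2\<close> has expectation \<open>d\<close> times \<open>lam_bar0 K\<close> because the processes are uncorrelated,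
  so the squared initial error is \<open>d\<close> times \<open>Lam K\<close>.
\<close>

section \<open>Square-integrable functions on finite measure spaces\<close>

lemma L2_mult_integrable:
  assumes "f \<in> L2 N" "g \<in> L2 N"
  shows "integrable N (\<lambda>x. f x * g x)"
proof (rule Bochner_Integration.integrable_bound)
  show "integrable N (\<lambda>x. (f x)\<^sup>2 + (g x)\<^sup>2)"
    using assms by (auto simp: L2_def)
  show "(\<lambda>x. f x * g x) \<in> borel_measurable N"
    using assms by (auto simp: L2_def)
  have "\<bar>a * b\<bar> \<le> a\<^sup>2 + b\<^sup>2" for a b :: real
    using sum_squares_bound[of "\<bar>a\<bar>" "\<bar>b\<bar>"] abs_ge_zero[of "a * b"] unfolding abs_mult power2_abs by linarith
  then show "AE x in N. norm (f x * g x) \<le> norm ((f x)\<^sup>2 + (g x)\<^sup>2)"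
    by simp
qed

lemma L2_const:
  assumes "finite_measure N"
  shows "(\<lambda>_. c) \<in> L2 N"
proof -
  interpret finite_measure N by fact
  show ?thesis by (simp add: L2_def)
qed

lemma L2_integrable:
  assumes "finite_measure N" "f \<in> L2 N"
  shows "integrable N f"
  using L2_mult_integrable[OF assms(2) L2_const[OF assms(1), of 1]] by simp

text \<open>The difference of the two sides is a variance, hence nonnegative. This bound controls
  averages over time by path energies.\<close>

lemma integral_square_le:
  assumes "prob_space N" "f \<in> L2 N"
  shows "(integral\<^sup>L N f)\<^sup>2 \<le> (\<integral>x. (f x)\<^sup>2 \<partial>N)"
proof -
  interpret prob_space N by fact
  have "variance f = expectation (\<lambda>x. (f x)\<^sup>2) - (expectation f)\<^sup>2"
    using assms(2) L2_integrable[OF finite_measure_axioms assms(2)]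
    by (intro variance_eq) (auto simp: L2_def)
  with variance_positive[of f] show ?thesis by simp
qed

lemma L2_norm_square: "(L2_norm N f)\<^sup>2 = (\<integral>x. (f x)\<^sup>2 \<partial>N)"
  by (simp add: L2_norm_def L2_inner_def power2_eq_square)

section \<open>Square-integrability and Fubini on a product of two probability spaces\<close>

context
  fixes M :: "'a measure" and N :: "'b measure"
  assumes M: "prob_space M" and N: "prob_space N"
begin

interpretation M: prob_space M by (fact M)
interpretation N: prob_space N by (fact N)
interpretation MN: pair_prob_space M N ..
interpretation NM: pair_prob_space N M ..

text \<open>Lets a random variable that does not depend on time enter \<open>L2_Fubini\<close> as
  one of the two factors.\<close>

lemma L2_pair_fst:
  assumes "f \<in> L2 M"
  shows "(\<lambda>p. f (fst p)) \<in> L2 (M \<Otimes>\<^sub>M N)"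
proof -
  have "integrable (M \<Otimes>\<^sub>M N) (\<lambda>p. (f (fst p))\<^sup>2)"
    using assms by (intro MN.Fubini_integrable) (auto simp: L2_def)
  then show ?thesis using assms by (auto simp: L2_def)
qed

text \<open>By \<open>integral_square_le\<close> on each section, the squared average is dominated
  by the average of the square, which is integrable by Fubini. It is what makes the time average of
  a process a square-integrable random variable.\<close>

lemma L2_section_integral:
  assumes f: "f \<in> L2 (M \<Otimes>\<^sub>M N)" and sec: "\<And>x. x \<in> space M \<Longrightarrow> (\<lambda>y. f (x, y)) \<in> L2 N"
  shows "(\<lambda>x. \<integral>y. f (x, y) \<partial>N) \<in> L2 M"
proof -
  have [measurable]: "f \<in> borel_measurable (M \<Otimes>\<^sub>M N)"
    using f by (simp add: L2_def)
  have "integrable M (\<lambda>x. (\<integral>y. f (x, y) \<partial>N)\<^sup>2)"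
  proof (rule Bochner_Integration.integrable_bound)
    show "integrable M (\<lambda>x. \<integral>y. (f (x, y))\<^sup>2 \<partial>N)"
      using f MN.integrable_fst'[of "\<lambda>p. (f p)\<^sup>2"] by (simp add: L2_def)
    show "AE x in M. norm ((\<integral>y. f (x, y) \<partial>N)\<^sup>2) \<le> norm (\<integral>y. (f (x, y))\<^sup>2 \<partial>N)"
      using integral_square_le[OF N sec] by (auto intro!: AE_I2 order_trans[OF _ abs_ge_self])
  qed measurable
  then show ?thesis by (simp add: L2_def)
qed

lemma L2_Fubini:
  assumes "f \<in> L2 (M \<Otimes>\<^sub>M N)" "g \<in> L2 (M \<Otimes>\<^sub>M N)"
  shows "(\<integral>x. \<integral>y. f (x, y) * g (x, y) \<partial>N \<partial>M) = (\<integral>y. \<integral>x. f (x, y) * g (x, y) \<partial>M \<partial>N)"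
  using MN.Fubini_integral[of "\<lambda>x y. f (x, y) * g (x, y)"] L2_mult_integrable[OF assms]
  by (simp add: case_prod_beta')

end

section \<open>Moments of sums of functions of single coordinates under a product measure\<close>

lemma PiM_integral_mult_components:
  fixes f g :: "'b \<Rightarrow> real"
  assumes N: "prob_space N" and I: "finite I" "j \<in> I" "k \<in> I" "j \<noteq> k"
    and f: "integrable N f" and g: "integrable N g"
  shows "integrable (PiM I (\<lambda>_. N)) (\<lambda>t. f (t j) * g (t k))"
    and "(\<integral>t. f (t j) * g (t k) \<partial>PiM I (\<lambda>_. N)) = integral\<^sup>L N f * integral\<^sup>L N g"
proof -
  interpret N: prob_space N by fact
  interpret product_prob_space "\<lambda>_. N" I ..
  \<comment> \<open>Padding with the constant \<open>1\<close> turns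
    \<open>f (t j) * g (t k)\<close> into a product over all of \<open>I\<close>, to which the
    product formula applies; the padding factors integrate to \<open>1\<close> because
    \<open>N\<close> is a probability measure.\<close>
  define h where "h = (\<lambda>i. if i = j then f else if i = k then g else (\<lambda>_. 1))"
  have h: "integrable N (h i)" for i
    using f g by (simp add: h_def)
  have I_eq: "I = insert j (insert k (I - {j, k}))"
    using I by auto
  have pr: "(\<Prod>i\<in>I. q i) = q j * q k" if "\<And>i. i \<in> I - {j, k} \<Longrightarrow> q i = 1" for q :: "_ \<Rightarrow> real"
    using I that by (subst I_eq) simp
  have h_prod: "(\<Prod>i\<in>I. h i (t i)) = f (t j) * g (t k)" for t
    using I by (subst pr) (auto simp: h_def)
  have "(\<Prod>i\<in>I. integral\<^sup>L N (h i)) = integral\<^sup>L N f * integral\<^sup>L N g"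
    using I by (subst pr) (auto simp: h_def N.prob_space)
  then show "(\<integral>t. f (t j) * g (t k) \<partial>PiM I (\<lambda>_. N)) = integral\<^sup>L N f * integral\<^sup>L N g"
    using product_integral_prod[of I h, OF I(1) h] by (simp add: h_prod)
  show "integrable (PiM I (\<lambda>_. N)) (\<lambda>t. f (t j) * g (t k))"
    using product_integrable_prod[of I h, OF I(1) h] by (simp add: h_prod)
qed

text \<open>The image of the product measure under a coordinate projection is the factor
  \<open>N\<close>, so this is a change of variables.\<close>

lemma PiM_integral_component:
  fixes f :: "'b \<Rightarrow> real"
  assumes N: "prob_space N" and j: "j \<in> I" and f: "integrable N f"
  shows "integrable (PiM I (\<lambda>_. N)) (\<lambda>t. f (t j))"
    and "(\<integral>t. f (t j) \<partial>PiM I (\<lambda>_. N)) = integral\<^sup>L N f"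
proof -
  interpret N: prob_space N by fact
  interpret product_prob_space "\<lambda>_. N" I ..
  have distr: "distr (PiM I (\<lambda>_. N)) N (\<lambda>t. t j) = N"
    using PiM_component[OF j] .
  have [measurable]: "(\<lambda>t. t j) \<in> PiM I (\<lambda>_. N) \<rightarrow>\<^sub>M N"
    using j by measurable
  show "integrable (PiM I (\<lambda>_. N)) (\<lambda>t. f (t j))"
    using f by (subst integrable_distr_eq[symmetric, where N = N]) (auto simp: distr)
  show "(\<integral>t. f (t j) \<partial>PiM I (\<lambda>_. N)) = integral\<^sup>L N f"
    using f by (subst integral_distr[symmetric, where N = N]) (auto simp: distr)
qed

context
  fixes N :: "'b measure" and I :: "'i set" and F :: "'i \<Rightarrow> 'b \<Rightarrow> real"
  assumes N: "prob_space N" and I: "finite I" and F: "\<And>j. j \<in> I \<Longrightarrow> F j \<in> L2 N"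
begin

lemma additive_first_moment:
  shows "integrable (PiM I (\<lambda>_. N)) (\<lambda>t. \<Sum>j\<in>I. F j (t j))"
    and "(\<integral>t. (\<Sum>j\<in>I. F j (t j)) \<partial>PiM I (\<lambda>_. N)) = (\<Sum>j\<in>I. integral\<^sup>L N (F j))"
proof -
  interpret N: prob_space N by (fact N)
  note int = PiM_integral_component[OF N _ L2_integrable[OF N.finite_measure_axioms F]]
  show "integrable (PiM I (\<lambda>_. N)) (\<lambda>t. \<Sum>j\<in>I. F j (t j))"
    by (intro Bochner_Integration.integrable_sum int)
  show "(\<integral>t. (\<Sum>j\<in>I. F j (t j)) \<partial>PiM I (\<lambda>_. N)) = (\<Sum>j\<in>I. integral\<^sup>L N (F j))"
    by (simp add: Bochner_Integration.integral_sum int)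
qed

lemma additive_second_moment:
  shows "integrable (PiM I (\<lambda>_. N)) (\<lambda>t. (\<Sum>j\<in>I. F j (t j))\<^sup>2)"
    and "(\<integral>t. (\<Sum>j\<in>I. F j (t j))\<^sup>2 \<partial>PiM I (\<lambda>_. N)) =
      (\<Sum>j\<in>I. (\<integral>x. (F j x)\<^sup>2 \<partial>N) - (integral\<^sup>L N (F j))\<^sup>2) + (\<Sum>j\<in>I. integral\<^sup>L N (F j))\<^sup>2"
proof -
  interpret N: prob_space N by (fact N)
  let ?m = "\<lambda>j. integral\<^sup>L N (F j)"
  let ?v = "\<lambda>j. (\<integral>x. (F j x)\<^sup>2 \<partial>N) - (?m j)\<^sup>2"
  note L1 = L2_integrable[OF N.finite_measure_axioms F]
  have sq: "integrable N (\<lambda>x. F j x * F j x)" if "j \<in> I" for j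
    using F[OF that] by (rule L2_mult_integrable) (rule F[OF that])
  \<comment> \<open>Off the diagonal, independence factors the integral. On the diagonal it is the
    second moment, split as squared mean plus variance, so that the products of means form a
    complete square when summed.\<close>
  have prod: "integrable (PiM I (\<lambda>_. N)) (\<lambda>t. F j (t j) * F k (t k)) \<and>
      (\<integral>t. F j (t j) * F k (t k) \<partial>PiM I (\<lambda>_. N)) = ?m j * ?m k + (if k = j then ?v j else 0)"
    if "j \<in> I" "k \<in> I" for j k
  proof (cases "k = j")
    case True
    then show ?thesis
      using PiM_integral_component[OF N that(1) sq[OF that(1)]] by (simp add: power2_eq_square)
  next
    case False
    then show ?thesis
      using PiM_integral_mult_components[OF N I that _ L1[OF that(1)] L1[OF that(2)]] by simp
  qed
  have expand: "(\<Sum>j\<in>I. F j (t j))\<^sup>2 = (\<Sum>j\<in>I. \<Sum>k\<in>I. F j (t j) * F k (t k))" for t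
    by (simp add: power2_eq_square sum_product)
  show "integrable (PiM I (\<lambda>_. N)) (\<lambda>t. (\<Sum>j\<in>I. F j (t j))\<^sup>2)"
    unfolding expand using prod by (intro Bochner_Integration.integrable_sum) blast
  have "(\<integral>t. (\<Sum>j\<in>I. F j (t j))\<^sup>2 \<partial>PiM I (\<lambda>_. N)) =
      (\<Sum>j\<in>I. \<Sum>k\<in>I. ?m j * ?m k + (if k = j then ?v j else 0))"
    unfolding expand using prod
    by (simp add: Bochner_Integration.integral_sum Bochner_Integration.integrable_sum cong: sum.cong)
  also have "\<dots> = (\<Sum>j\<in>I. ?v j) + (\<Sum>j\<in>I. ?m j)\<^sup>2"
    using I by (simp add: sum.distrib power2_eq_square sum_product)
  finally show "(\<integral>t. (\<Sum>j\<in>I. F j (t j))\<^sup>2 \<partial>PiM I (\<lambda>_. N)) = (\<Sum>j\<in>I. ?v j) + (\<Sum>j\<in>I. ?m j)\<^sup>2" .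
qed

text \<open>Variance is second moment minus squared mean, and the squared sum of means
  cancels.\<close>

lemma additive_variance:
  "(\<integral>t. ((\<Sum>j\<in>I. F j (t j)) - (\<integral>s. (\<Sum>j\<in>I. F j (s j)) \<partial>PiM I (\<lambda>_. N)))\<^sup>2 \<partial>PiM I (\<lambda>_. N)) =
    (\<Sum>j\<in>I. (\<integral>x. (F j x)\<^sup>2 \<partial>N) - (integral\<^sup>L N (F j))\<^sup>2)"
proof -
  interpret P: prob_space "PiM I (\<lambda>_. N)"
    by (intro prob_space_PiM N)
  show ?thesis
    using P.variance_eq[OF additive_first_moment(1) additive_second_moment(1)]
    by (simp add: additive_first_moment(2) additive_second_moment(2))
qed

end

section \<open>The uniform distribution on the unit interval\<close>

lemma prob_space_unit_interval: "prob_space unit_interval"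
  unfolding unit_interval_def by (rule prob_space_restrict_space) auto

lemma space_unit_interval [simp]: "space unit_interval = {0..1}"
  by (simp add: unit_interval_def space_restrict_space)

lemma integral_unit_interval: "integral\<^sup>L unit_interval f = (LBINT t:{0..1}. f t)"
  for f :: "real \<Rightarrow> real"
  unfolding unit_interval_def set_lebesgue_integral_def by (subst integral_restrict_space) auto

lemma integrable_unit_interval:
  fixes f :: "real \<Rightarrow> real"
  assumes "continuous_on {0..1} f"
  shows "integrable unit_interval f"
  using borel_integrable_atLeastAtMost'[OF assms]
  unfolding unit_interval_def set_integrable_def by (subst integrable_restrict_space) auto

section \<open>Errors of the additive field with no and with one approximating function\<close>

theorem mainTheorem3:
  fixes M :: "'a measure"
    and X :: "nat \<Rightarrow> real \<Rightarrow> 'a \<Rightarrow> real"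
    and K :: "real \<Rightarrow> real \<Rightarrow> real"
  assumes "prob_space M"
    and joint_measurable: "\<And>j. 1 \<le> j \<Longrightarrow>
      (\<lambda>(\<omega>, t). X j t \<omega>) \<in> borel_measurable (M \<Otimes>\<^sub>M unit_interval)"
    and paths: "\<And>j \<omega>. 1 \<le> j \<Longrightarrow> \<omega> \<in> space M \<Longrightarrow> (\<lambda>t. X j t \<omega>) \<in> L2 unit_interval"
    and second_moments: "\<And>j t. 1 \<le> j \<Longrightarrow> t \<in> {0..1} \<Longrightarrow> X j t \<in> L2 M"
    and zero_mean: "\<And>j t. 1 \<le> j \<Longrightarrow> t \<in> {0..1} \<Longrightarrow> (\<integral>\<omega>. X j t \<omega> \<partial>M) = 0"
    and covariance: "\<And>j t s. 1 \<le> j \<Longrightarrow> t \<in> {0..1} \<Longrightarrow> s \<in> {0..1} \<Longrightarrow>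
      (\<integral>\<omega>. X j t \<omega> * X j s \<omega> \<partial>M) = K t s"
    and continuous: "continuous_on ({0..1} \<times> {0..1}) (\<lambda>(t, s). K t s)"
    and uncorrelated: "\<And>j k t s. 1 \<le> j \<Longrightarrow> 1 \<le> k \<Longrightarrow> j \<noteq> k \<Longrightarrow> t \<in> {0..1} \<Longrightarrow> s \<in> {0..1} \<Longrightarrow>
      (\<integral>\<omega>. X j t \<omega> * X k s \<omega> \<partial>M) = 0"
  shows "(Lam_bar K = 0 \<longrightarrow>
            (\<forall>\<epsilon>\<in>{0<..<1}. \<forall>d\<ge>1. approx_complexity M d (additive_field X d) \<epsilon> = 1))
       \<and> (Lam_bar K \<noteq> 0 \<and> sqrt (Lam_bar K / Lam K) < 1 \<longrightarrow>
            (\<forall>\<epsilon>\<in>{sqrt (Lam_bar K / Lam K)..<1}. \<forall>d\<ge>1.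
               approx_complexity M d (additive_field X d) \<epsilon> = 1))"
proof -
  interpret M: prob_space M by fact
  interpret U: prob_space unit_interval by (rule prob_space_unit_interval)
  interpret MU: pair_prob_space M unit_interval ..
  interpret UM: pair_prob_space unit_interval M ..
  let ?U = unit_interval
  define m where "m j \<omega> = (\<integral>t. X j t \<omega> \<partial>?U)" for j \<omega>
  define v where "v j \<omega> = (\<integral>t. (X j t \<omega>)\<^sup>2 \<partial>?U)" for j \<omega>

  have diag: "continuous_on {0..1} (\<lambda>t. K t t)"
    using continuous_on_compose2[OF continuous, of "{0..1}" "\<lambda>t. (t, t)"]
    by (simp add: continuous_on_Pair image_subset_iff)
  \<comment> \<open>Integrability of the square is checked with \<open>\<omega>\<close> innermost,
    since the hypotheses give the second moment at a fixed time: the inner integral is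
    \<open>K t t\<close>, continuous and so integrable. The factors are swapped back
    afterwards.\<close>
  have XL2: "(\<lambda>p. X j (snd p) (fst p)) \<in> L2 (M \<Otimes>\<^sub>M ?U)" if j: "1 \<le> j" for j
  proof -
    have meas[measurable]: "(\<lambda>p. X j (snd p) (fst p)) \<in> borel_measurable (M \<Otimes>\<^sub>M ?U)"
      using joint_measurable[OF j] by (simp add: case_prod_beta')
    have "integrable (?U \<Otimes>\<^sub>M M) (\<lambda>p. (X j (fst p) (snd p))\<^sup>2)"
    proof (rule UM.Fubini_integrable)
      show "(\<lambda>p. (X j (fst p) (snd p))\<^sup>2) \<in> borel_measurable (?U \<Otimes>\<^sub>M M)"
        using measurable_compose[OF measurable_pair_swap' meas] by (simp add: case_prod_beta')
      have "integrable ?U (\<lambda>t. K t t)" by (rule integrable_unit_interval[OF diag])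
      then show "integrable ?U (\<lambda>t. \<integral>\<omega>. norm ((X j (fst (t, \<omega>)) (snd (t, \<omega>)))\<^sup>2) \<partial>M)"
        by (rule Bochner_Integration.integrable_cong[THEN iffD1, rotated 2])
          (use covariance[OF j] in \<open>auto simp: power2_eq_square\<close>)
      show "AE t in ?U. integrable M (\<lambda>\<omega>. (X j (fst (t, \<omega>)) (snd (t, \<omega>)))\<^sup>2)"
        using second_moments[OF j] by (auto simp: L2_def)
    qed
    then have "integrable (M \<Otimes>\<^sub>M ?U) (\<lambda>p. (X j (snd p) (fst p))\<^sup>2)"
      using UM.integrable_product_swap[of "\<lambda>p. (X j (fst p) (snd p))\<^sup>2"] by (simp add: case_prod_beta')
    then show ?thesis using meas by (simp add: L2_def)
  qed
  have m_L2: "m j \<in> L2 M" if j: "1 \<le> j" for j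
    using L2_section_integral[OF M.prob_space_axioms U.prob_space_axioms XL2[OF j]] paths[OF j]
    by (simp add: m_def[abs_def])
  have v_int: "integrable M (v j)" if j: "1 \<le> j" for j
    using XL2[OF j] MU.integrable_fst'[of "\<lambda>p. (X j (snd p) (fst p))\<^sup>2"]
    by (simp add: v_def[abs_def] L2_def)
  have Ev: "integral\<^sup>L M (v j) = Lam K" if j: "1 \<le> j" for j
  proof -
    have "integral\<^sup>L M (v j) = (\<integral>t. \<integral>\<omega>. X j t \<omega> * X j t \<omega> \<partial>M \<partial>?U)"
      using L2_Fubini[OF M.prob_space_axioms U.prob_space_axioms XL2[OF j] XL2[OF j]]
      by (simp add: v_def[abs_def] power2_eq_square)
    also have "\<dots> = (\<integral>t. K t t \<partial>?U)"
      using covariance[OF j] by (intro Bochner_Integration.integral_cong) auto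
    finally show ?thesis by (simp add: integral_unit_interval Lam_def)
  qed
  have Em: "(\<integral>\<omega>. m j \<omega> * m k \<omega> \<partial>M) = (if j = k then lam_bar0 K else 0)"
    if j: "1 \<le> j" and k: "1 \<le> k" for j k
  proof -
    \<comment> \<open>The two time averages are pulled out of the expectation one at a time, each by
      one use of \<open>L2_Fubini\<close>.\<close>
    have inner: "(\<integral>\<omega>. X j s \<omega> * m k \<omega> \<partial>M) = (\<integral>t. (if j = k then K t s else 0) \<partial>?U)"
      if s: "s \<in> {0..1}" for s
    proof -
      have "(\<integral>\<omega>. X j s \<omega> * m k \<omega> \<partial>M) = (\<integral>t. \<integral>\<omega>. X j s \<omega> * X k t \<omega> \<partial>M \<partial>?U)"
        using L2_Fubini[OF M.prob_space_axioms U.prob_space_axioms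
            L2_pair_fst[OF M.prob_space_axioms U.prob_space_axioms second_moments[OF j s]] XL2[OF k]]
        by (simp add: m_def)
      also have "\<dots> = (\<integral>t. (if j = k then K t s else 0) \<partial>?U)"
        using covariance[OF j _ s] uncorrelated[OF j k _ s]
        by (intro Bochner_Integration.integral_cong) (auto simp: mult.commute)
      finally show ?thesis .
    qed
    have "(\<integral>\<omega>. m j \<omega> * m k \<omega> \<partial>M) = (\<integral>s. \<integral>\<omega>. X j s \<omega> * m k \<omega> \<partial>M \<partial>?U)"
      using L2_Fubini[OF M.prob_space_axioms U.prob_space_axioms XL2[OF j]
          L2_pair_fst[OF M.prob_space_axioms U.prob_space_axioms m_L2[OF k]]]
      by (simp add: m_def[of j])
    also have "\<dots> = (\<integral>s. \<integral>t. (if j = k then K t s else 0) \<partial>?U \<partial>?U)"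
      using inner by (intro Bochner_Integration.integral_cong) auto
    finally show ?thesis by (simp add: integral_unit_interval lam_bar0_def)
  qed
  have Em2: "(\<integral>\<omega>. (m j \<omega>)\<^sup>2 \<partial>M) = lam_bar0 K" if "1 \<le> j" for j
    using Em[OF that that] by (simp add: power2_eq_square)
  have m2_int: "integrable M (\<lambda>\<omega>. (m j \<omega>)\<^sup>2)" if "1 \<le> j" for j
    using m_L2[OF that] by (simp add: L2_def)
  \<comment> \<open>Both constants are expectations of nonnegative variables built from the process
    with index \<open>1\<close>, which fixes their signs.\<close>
  have Lam_nonneg: "0 \<le> Lam K"
    unfolding Ev[OF order_refl, symmetric] by (rule integral_nonneg_AE) (simp add: v_def)
  have lam_bar0_nonneg: "0 \<le> lam_bar0 K"
    unfolding Em2[OF order_refl, symmetric] by (rule integral_nonneg_AE) simp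
  have Evar: "(\<integral>\<omega>. (\<Sum>j=1..d. v j \<omega> - (m j \<omega>)\<^sup>2) \<partial>M) = d * Lam_bar K" for d
    by (simp add: Bochner_Integration.integral_sum Bochner_Integration.integral_diff v_int m2_int
        Ev Em2 Lam_bar_def)

  have error0: "avg_error M d (additive_field X d) 0 = sqrt (d * Lam K)" for d
  proof -
    \<comment> \<open>The squared mean is kept as a double sum so that its expectation can be taken
      term by term; by \<open>Em\<close> only the diagonal survives.\<close>
    have "(L2_norm (unit_cube d) (\<lambda>t. additive_field X d t \<omega>))\<^sup>2 =
        (\<Sum>j=1..d. v j \<omega> - (m j \<omega>)\<^sup>2) + (\<Sum>j=1..d. \<Sum>k=1..d. m j \<omega> * m k \<omega>)"
      if "\<omega> \<in> space M" for \<omega>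
      using additive_second_moment(2)[OF U.prob_space_axioms, of "{1..d}" "\<lambda>j t. X j t \<omega>"]
        paths[OF _ that]
      unfolding sum_product[symmetric] power2_eq_square[of "sum _ _", symmetric]
      by (simp add: L2_norm_square unit_cube_def additive_field_def v_def m_def)
    then have "(\<integral>\<omega>. (L2_norm (unit_cube d) (\<lambda>t. additive_field X d t \<omega>))\<^sup>2 \<partial>M) =
        (\<integral>\<omega>. (\<Sum>j=1..d. v j \<omega> - (m j \<omega>)\<^sup>2) + (\<Sum>j=1..d. \<Sum>k=1..d. m j \<omega> * m k \<omega>) \<partial>M)"
      by (intro Bochner_Integration.integral_cong) auto
    also have "\<dots> = d * Lam_bar K + (\<integral>\<omega>. (\<Sum>j=1..d. \<Sum>k=1..d. m j \<omega> * m k \<omega>) \<partial>M)"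
      unfolding Evar[symmetric]
      by (intro Bochner_Integration.integral_add Bochner_Integration.integrable_sum
          Bochner_Integration.integrable_diff v_int m2_int L2_mult_integrable m_L2) auto
    also have "(\<integral>\<omega>. (\<Sum>j=1..d. \<Sum>k=1..d. m j \<omega> * m k \<omega>) \<partial>M) =
        (\<Sum>j=1..d. \<integral>\<omega>. (\<Sum>k=1..d. m j \<omega> * m k \<omega>) \<partial>M)"
      by (intro Bochner_Integration.integral_sum Bochner_Integration.integrable_sum
          L2_mult_integrable m_L2) auto
    also have "\<dots> = (\<Sum>j=1..d. \<Sum>k=1..d. \<integral>\<omega>. m j \<omega> * m k \<omega> \<partial>M)"
      by (intro sum.cong refl Bochner_Integration.integral_sum L2_mult_integrable m_L2) auto
    also have "\<dots> = (\<Sum>j=1..d. \<Sum>k=1..d. if j = k then lam_bar0 K else 0)"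
      by (intro sum.cong refl Em) auto
    also have "\<dots> = d * lam_bar0 K" by simp
    finally show ?thesis by (simp add: avg_error_def Lam_bar_def algebra_simps)
  qed

  have error1: "avg_error M d (additive_field X d) 1 \<le> sqrt (d * Lam_bar K)" for d
  proof -
    interpret P: prob_space "unit_cube d"
      unfolding unit_cube_def by (intro prob_space_PiM U.prob_space_axioms)
    \<comment> \<open>The inner product with the constant \<open>1\<close> is the mean over the
      cube, so the residual is the centred path. The one-term sum matches the form in
      \<open>avg_error\<close>.\<close>
    have res: "(L2_norm (unit_cube d) (\<lambda>t. additive_field X d t \<omega> - (\<Sum>i=1..1::nat.
          L2_inner (unit_cube d) (\<lambda>s. additive_field X d s \<omega>) (\<lambda>_. 1) * 1)))\<^sup>2 =
        (\<Sum>j=1..d. v j \<omega> - (m j \<omega>)\<^sup>2)"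
      if "\<omega> \<in> space M" for \<omega>
      using additive_variance[OF U.prob_space_axioms, of "{1..d}" "\<lambda>j t. X j t \<omega>"] paths[OF _ that]
      by (simp add: L2_norm_square L2_inner_def unit_cube_def additive_field_def v_def m_def)
    have "(\<integral>\<omega>. (L2_norm (unit_cube d) (\<lambda>t. additive_field X d t \<omega> - (\<Sum>i=1..1::nat.
          L2_inner (unit_cube d) (\<lambda>s. additive_field X d s \<omega>) (\<lambda>_. 1) * 1)))\<^sup>2 \<partial>M) = d * Lam_bar K"
      unfolding Evar[symmetric] using res by (intro Bochner_Integration.integral_cong) auto
    note E = this[symmetric]
    show ?thesis
      unfolding avg_error_def E
      \<comment> \<open>The constant function \<open>1\<close> is an admissible choice, and an
        infimum of values bounded below by \<open>0\<close> is at most each of them.\<close>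
      by (simp only: one_neq_zero if_False, rule cInf_lower)
        (auto intro!: exI[of _ "\<lambda>_ _. 1"] bdd_belowI[of _ 0] integral_nonneg_AE
          L2_const P.finite_measure_axioms)
  qed

  \<comment> \<open>The minimum ranges over \<open>n\<close> from \<open>1\<close> on, so an upper
    bound for the error at \<open>n = 1\<close> settles it.\<close>
  have complexity: "approx_complexity M d (additive_field X d) \<epsilon> = 1"
    if "sqrt (d * Lam_bar K) \<le> \<epsilon> * sqrt (d * Lam K)" for d \<epsilon>
    unfolding approx_complexity_def
    using error1[of d] that by (intro Least_equality) (auto simp: error0)

  \<comment> \<open>This serves both halves of the claim: for \<open>Lam_bar K = 0\<close> the
    threshold is \<open>0\<close>.\<close>
  have "sqrt (d * Lam_bar K) \<le> \<epsilon> * sqrt (d * Lam K)"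
    if "sqrt (Lam_bar K / Lam K) \<le> \<epsilon>" for d :: nat and \<epsilon>
  proof (cases "Lam K = 0")
    \<comment> \<open>Here the quotient is \<open>0\<close> by the convention for division by zero
      and says nothing; instead \<open>Lam_bar K\<close> equals minus \<open>lam_bar0 K\<close>, so
      the left side is at most \<open>0\<close>, while the right side is \<open>0\<close>.\<close>
    case True
    then have "real d * Lam_bar K \<le> 0"
      using lam_bar0_nonneg by (simp add: Lam_bar_def mult_nonneg_nonneg)
    with True show ?thesis by simp
  next
    case False
    then have "sqrt (d * Lam_bar K) = sqrt (Lam_bar K / Lam K) * sqrt (d * Lam K)"
      by (simp flip: real_sqrt_mult)
    also have "\<dots> \<le> \<epsilon> * sqrt (d * Lam K)"
      using that Lam_nonneg by (intro mult_right_mono) auto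
    finally show ?thesis .
  qed
  with complexity Lam_nonneg show ?thesis
    by auto
qed

end
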